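(* Let $f\in\Gamma_0(\mathbb{R}^n)$ be $L$-Lipschitz. Then for all $x\in\operatorname{dom} f$ and any $r>0$, $$0\le f(x)-e_rf(x)\le\frac{L^2}{2r}.$$
   Context: $\Gamma_0(\mathbb{R}^n)$ is the set of proper, convex, lower semicontinuous functions $f:\mathbb{R}^n\to\mathbb{R}\cup\{\infty\}$, and $\operatorname{dom} f=\{x: f(x)<\infty\}$. $\|\cdot\|$ is the Euclidean norm. $f$ is $L$-Lipschitz if $|f(x)-f(y)|\le L\|x-y\|$ for all $x,y\in\operatorname{dom} f$. The Moreau envelope is $e_rf(x)=\inf_{y\in\mathbb{R}^n}\{f(y)+\frac r2\|y-x\|^2\}$. *)

theory Defs
  imports "HOL-Analysis.Analysis"
begin

text \<open>Extended-valued functions have the codomain \<^typ>\<open>ereal\<close>; the value \<open>-\<infinity>\<close>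
  is excluded by properness.\<close>

definition eff_dom :: "('a \<Rightarrow> ereal) \<Rightarrow> 'a set" where
  "eff_dom f = {x. f x < \<infinity>}"

definition proper_fun :: "('a \<Rightarrow> ereal) \<Rightarrow> bool" where
  "proper_fun f \<longleftrightarrow> (\<forall>x. f x \<noteq> -\<infinity>) \<and> eff_dom f \<noteq> {}"

text \<open>The end points \<open>u = 0\<close> and \<open>v = 0\<close> are harmless because \<open>0 * \<infinity> = 0\<close> in \<^typ>\<open>ereal\<close>.
  The definition is meant for functions without the value \<open>-\<infinity>\<close>.\<close>

definition convex_fun :: "('a::real_vector \<Rightarrow> ereal) \<Rightarrow> bool" where
  "convex_fun f \<longleftrightarrow>
     (\<forall>x y. \<forall>u\<ge>0. \<forall>v\<ge>0. u + v = 1 \<longrightarrow>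
        f (u *\<^sub>R x + v *\<^sub>R y) \<le> ereal u * f x + ereal v * f y)"

definition lsc_fun :: "('a::topological_space \<Rightarrow> ereal) \<Rightarrow> bool" where
  "lsc_fun f \<longleftrightarrow> (\<forall>x. f x \<le> Liminf (at x) f)"

definition Gamma0 :: "('a::euclidean_space \<Rightarrow> ereal) set" where
  "Gamma0 = {f. proper_fun f \<and> convex_fun f \<and> lsc_fun f}"

definition lipschitz_on_dom :: "real \<Rightarrow> ('a::real_normed_vector \<Rightarrow> ereal) \<Rightarrow> bool" where
  "lipschitz_on_dom L f \<longleftrightarrow>
     (\<forall>x\<in>eff_dom f. \<forall>y\<in>eff_dom f. \<bar>f x - f y\<bar> \<le> ereal (L * norm (x - y)))"

definition moreau_envelope :: "real \<Rightarrow> ('a::real_normed_vector \<Rightarrow> ereal) \<Rightarrow> 'a \<Rightarrow> ereal" where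
  "moreau_envelope r f x = (INF y. f y + ereal (r / 2 * (norm (y - x))\<^sup>2))"

end

theory Submission
  imports Defs
begin

text \<open>Taking y = x in the infimum shows that the envelope is at most \<open>f x\<close>.
  Conversely, put t = \<open>norm (y - x)\<close>. For y in the domain the Lipschitz bound gives
  f(y) \<ge> f(x) - L t, so each competitor is at least f(x) + (r/2) t^2 - L t. By
  \<open>linear_le_quadratic\<close> this is at least f(x) - L^2/(2r), a bound independent of y that
  passes to the infimum.\<close>

lemma linear_le_quadratic:
  fixes L r t :: real
  assumes "r > 0"
  shows "L * t \<le> r / 2 * t\<^sup>2 + L\<^sup>2 / (2 * r)"
proof -
  \<comment> \<open>Completing the square: this is the gap between the two sides, zero exactly at t
    = L/r.\<close>
  have "0 \<le> (r * t - L)\<^sup>2 / (2 * r)"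
    using assms by simp
  also have "\<dots> = r / 2 * t\<^sup>2 + L\<^sup>2 / (2 * r) - L * t"
    using assms by (simp add: field_simps power2_eq_square)
  finally show ?thesis by simp
qed

lemma moreau_envelope_le: "moreau_envelope r f x \<le> f x"
proof -
  have "moreau_envelope r f x \<le> f x + ereal (r / 2 * (norm (x - x))\<^sup>2)"
    unfolding moreau_envelope_def by (rule INF_lower) simp
  then show ?thesis by simp
qed

text \<open>Naming the finite value \<open>a\<close> of \<open>f x\<close> keeps the subtraction in
  the reals, away from \<infinity> - \<infinity>.\<close>

lemma moreau_envelope_ge:
  fixes f :: "'a::real_normed_vector \<Rightarrow> ereal"
  assumes proper: "proper_fun f" and lip: "lipschitz_on_dom L f"
    and fx: "f x = ereal a" and "r > 0"
  shows "ereal (a - L\<^sup>2 / (2 * r)) \<le> moreau_envelope r f x"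
  unfolding moreau_envelope_def
proof (rule INF_greatest)
  fix y
  show "ereal (a - L\<^sup>2 / (2 * r)) \<le> f y + ereal (r / 2 * (norm (y - x))\<^sup>2)"
  proof (cases "f y")
    case (real b)
    have "x \<in> eff_dom f" "y \<in> eff_dom f"
      using real fx by (simp_all add: eff_dom_def)
    then have "\<bar>f x - f y\<bar> \<le> ereal (L * norm (x - y))"
      using lip unfolding lipschitz_on_dom_def by blast
    then have "a - b \<le> L * norm (y - x)"
      using real fx by (simp add: norm_minus_commute)
    also have "\<dots> \<le> r / 2 * (norm (y - x))\<^sup>2 + L\<^sup>2 / (2 * r)"
      using \<open>r > 0\<close> by (rule linear_le_quadratic)
    finally show ?thesis using real by simp
  next
    \<comment> \<open>Outside the domain the Lipschitz condition is silent, but the competitor is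
      \<infinity>.\<close>
    case PInf
    then show ?thesis by simp
  next
    case MInf
    then show ?thesis using proper by (simp add: proper_fun_def)
  qed
qed

theorem proposition3p4:
  fixes f :: "real ^ 'n \<Rightarrow> ereal" and L r :: real and x :: "real ^ 'n"
  assumes "f \<in> Gamma0"
    and "lipschitz_on_dom L f"
    and "x \<in> eff_dom f"
    and "r > 0"
  shows "0 \<le> f x - moreau_envelope r f x \<and>
         f x - moreau_envelope r f x \<le> ereal (L\<^sup>2 / (2 * r))"
proof -
  have proper: "proper_fun f"
    using assms(1) by (simp add: Gamma0_def)
  then obtain a where a: "f x = ereal a"
    using assms(3) by (cases "f x") (auto simp: proper_fun_def eff_dom_def)
  have lower: "ereal (a - L\<^sup>2 / (2 * r)) \<le> moreau_envelope r f x"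
    using proper assms(2) a assms(4) by (rule moreau_envelope_ge)
  have upper: "moreau_envelope r f x \<le> ereal a"
    using moreau_envelope_le[of r f x] a by simp
  \<comment> \<open>Real bounds on both sides force the envelope to be finite, so the infinite cases
    are contradictory and the rest is real arithmetic.\<close>
  from lower upper a show ?thesis
    by (cases "moreau_envelope r f x") auto
qed

end
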